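(* Let $\sigma=\sigma_0\cdots\sigma_{\rho-1}$ be a decomposition of $\sigma$ into simple sequences and let $B_0,\dots,B_{\rho-1}$ be the branches of the dual graph. Then (i) $\Delta_\sigma=\prod_{i=0}^{\rho-1}\Delta_{\sigma_i}=\prod_{i=0}^{\rho-1}\det B_i$; (ii) $P_{A(\sigma)}=\prod_{i=0}^{\rho-1}\bigl(P_{A(\sigma_i)}+1\bigr)-1=\prod_{i=0}^{\rho-1}\det B_i-1$. (Different polynomials depend on different indeterminates.)
   Context: For $k\ge1$ the singular sequence $s_k$ is $(k+2,2,\dots,2)$ (length $k$); for $m\ge1$ the regular sequence $r_m$ is $(2,\dots,2)$ (length $m$). A simple sequence is a sequence of the form $s_{k_0}\cdots s_{k_{p-1}}r_m$ with $p\ge1$. Let $\sigma$ be a concatenation of simple sequences with, in total, $N$ singular sequences, numbered $0,\dots,N-1$ in order; $A(\sigma)\subset\mathbb Z/N\mathbb Z$ is the set of indices $j$ such that the $j$-th singular sequence is immediately followed by a regular sequence. Let $N\ge1$ and $A=\{a_1,\dots,a_p\}\subset\mathbb Z/N\mathbb Z$ with $0\le a_1<\dots<a_p\le N-1$. Define a partition of $\mathbb Z/N\mathbb Z$ into blocks by $A_1=\{k\mid 0\le k\le a_1 \text{ or } a_p<k\le N-1\}$ and $A_i=\{k\mid a_{i-1}<k\le a_i\}$ for $2\le i\le p$; if $A=\emptyset$ the only block is $A_1=\mathbb Z/N\mathbb Z$. A proper subset $B\subsetneq\mathbb Z/N\mathbb Z$ is generating allowed relatively to $A$ if either $B=\{a\}$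 with $a\in A$, or $B=\{k,k+1\}$ and $B$ is contained in one of the blocks $A_i$; a proper subset is allowed if it admits a (possibly empty) partition into generating allowed subsets; $\mathcal P_A$ is the set of allowed subsets, and $P_A(X_0,\dots,X_{N-1})=\sum_{B\in\mathcal P_A}\prod_{i\notin B}X_i$. Put $\Delta_\sigma(X_0,\dots,X_{N-1})=P_{A(\sigma)}(X_0,\dots,X_{N-1})+1$. In the products, the indeterminates of $\Delta_\sigma$ and $P_{A(\sigma)}$ are split into consecutive groups, one for each $\sigma_i$; the equalities with determinants are understood after substituting for the indeterminates the lengths of the singular sequences of $\sigma$, in order. The branch of the dual graph corresponding to a simple sequence $s_{k_0}\cdots s_{k_{p-1}}r_m$ is the chain of curves with opposite self-intersections, in order, $$(\underbrace{2,\dots,2}_{k_0-1},k_1+2,\underbrace{2,\dots,2}_{k_2-1},\dots,k_{p-2}+2,\underbrace{2,\dots,2}_{k_{p-1}-1},2)\quad\text{if } p \text{ is odd},$$ $$(\underbrace{2,\dots,2}_{k_0-1},k_1+2,\underbrace{2,\dots,2}_{k_2-1},\dots,k_{p-3}+2,\underbrace{2,\dots,2}_{k_{p-2}-1},k_{p-1}+2)\quad\text{if } p \text{ is even}.$$ For a chain $B$ with opposite self-intersections $(b_1,\dots,b_r)$, $\det B$ is the determinant of the tridiagonal matrix with diagonal entries $b_1,\dots,b_r$ and entries $-1$ next to the diagonal.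
   Formalization: A pair {k,k+1} is generating allowed only if moreover k is not in A; this matters only when A={a} and N≥3, where it excludes {a,a+1}. With that pair admitted the statement fails: for N=3, A={2}, lengths 1,1,1, Δ would be 6 but det B is 5. *)

theory Defs
  imports
    "Jordan_Normal_Form.Determinant"
    "HOL-Library.Poly_Mapping"
    "HOL-Library.Disjoint_Sets"
begin

definition singular_seq :: "nat \<Rightarrow> nat list" where
  "singular_seq k = (k + 2) # replicate (k - 1) 2"

definition regular_seq :: "nat \<Rightarrow> nat list" where
  "regular_seq m = replicate m 2"

definition simple_seq :: "nat list \<Rightarrow> bool" where
  "simple_seq \<tau> \<longleftrightarrow>
     (\<exists>ks m. ks \<noteq> [] \<and> (\<forall>k\<in>set ks. 1 \<le> k) \<and> 1 \<le> m \<and>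
        \<tau> = concat (map singular_seq ks) @ regular_seq m)"

datatype piece = Sing nat | Reg nat

fun piece_seq :: "piece \<Rightarrow> nat list" where
  "piece_seq (Sing k) = singular_seq k"
| "piece_seq (Reg m) = regular_seq m"

text \<open>Two adjacent regular sequences are excluded, since
  \<open>r\<^sub>m r\<^sub>n = r\<^sub>m\<^sub>+\<^sub>n\<close>; with this convention the factorization of a sequence of integers
  into singular and regular sequences is unique (lemma \<open>factorization_unique\<close>).\<close>

fun well_formed :: "piece list \<Rightarrow> bool" where
  "well_formed [] \<longleftrightarrow> True"
| "well_formed (Sing k # w) \<longleftrightarrow> 1 \<le> k \<and> well_formed w"
| "well_formed (Reg m # w) \<longleftrightarrow> 1 \<le> m \<and> (\<forall>n v. w \<noteq> Reg n # v) \<and> well_formed w"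

definition factorization :: "nat list \<Rightarrow> piece list" where
  "factorization \<sigma> = (THE w. well_formed w \<and> concat (map piece_seq w) = \<sigma>)"

lemma takeWhile_after_regular:
  assumes "well_formed (Reg m # w)"
  shows "takeWhile (\<lambda>x. x = 2) (concat (map piece_seq (Reg m # w))) = replicate m 2"
proof -
  have "takeWhile (\<lambda>x. x = 2) (concat (map piece_seq w)) = []"
  proof (cases w)
    case (Cons p v)
    with assms obtain k where "p = Sing k" "1 \<le> k"
      by (cases p) auto
    with Cons show ?thesis
      by (simp add: singular_seq_def)
  qed simp
  then show ?thesis
    by (simp add: regular_seq_def takeWhile_append)
qed

lemma factorization_unique:
  assumes "well_formed v" "well_formed w"
    and "concat (map piece_seq v) = concat (map piece_seq w)"
  shows "v = w"
  using assms
proof (induction v arbitrary: w)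
  case Nil
  then show ?case
    by (cases w rule: well_formed.cases) (auto simp: singular_seq_def regular_seq_def)
next
  case (Cons p v)
  obtain q u where w: "w = q # u"
    using Cons.prems
    by (cases w; cases p) (auto simp: singular_seq_def regular_seq_def)
  have "p = q"
  proof (cases p)
    case p: (Sing k)
    show ?thesis
    proof (cases q)
      case (Sing l)
      with Cons.prems p w show ?thesis
        by (simp add: singular_seq_def)
    next
      case (Reg n)
      with Cons.prems p w show ?thesis
        by (cases n) (auto simp: singular_seq_def regular_seq_def)
    qed
  next
    case p: (Reg m)
    show ?thesis
    proof (cases q)
      case (Sing l)
      with Cons.prems p w show ?thesis
        by (cases m) (auto simp: singular_seq_def regular_seq_def)
    next
      case (Reg n)
      with Cons.prems p w have "replicate m (2::nat) = replicate n 2"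
        using takeWhile_after_regular[of m v] takeWhile_after_regular[of n u]
        by (simp del: replicate_eq_replicate)
      with p Reg show ?thesis
        by simp
    qed
  qed
  moreover have "well_formed v" "well_formed u"
    using Cons.prems w by (cases p; cases q; simp)+
  ultimately show ?case
    using Cons.IH[of u] Cons.prems w by simp
qed

lemma factorization_eq:
  assumes "well_formed w"
  shows "factorization (concat (map piece_seq w)) = w"
  unfolding factorization_def
  using assms factorization_unique by blast

text \<open>The lengths of the singular sequences of \<open>\<sigma>\<close>, in order; their number is \<open>N\<close>.\<close>

definition sing_lengths_of :: "piece list \<Rightarrow> nat list" where
  "sing_lengths_of w = concat (map (\<lambda>p. case p of Sing k \<Rightarrow> [k] | Reg m \<Rightarrow> []) w)"

definition sing_lengths :: "nat list \<Rightarrow> nat list" where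
  "sing_lengths \<sigma> = sing_lengths_of (factorization \<sigma>)"

definition num_sing :: "nat list \<Rightarrow> nat" where
  "num_sing \<sigma> = length (sing_lengths \<sigma>)"

definition A_of :: "nat list \<Rightarrow> nat set" where
  "A_of \<sigma> = {length (sing_lengths_of u) | u k m v. factorization \<sigma> = u @ Sing k # Reg m # v}"

text \<open>\<open>\<int>/N\<int>\<close> is represented by \<open>{..<N}\<close>, the successor of \<open>k\<close> being \<open>Suc k mod N\<close>.
  Below, \<open>a = [a\<^sub>1, \<dots>, a\<^sub>p]\<close> is a list, so \<open>a\<^sub>i\<close> is \<open>a ! (i - 1)\<close>.\<close>

definition blocks :: "nat \<Rightarrow> nat set \<Rightarrow> nat set set" where
  "blocks N A =
     (if A = {} then {{..<N}}
      else let a = sorted_list_of_set A; p = length a in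
        insert {k. k < N \<and> (k \<le> a ! 0 \<or> a ! (p - 1) < k)}
          {{k. a ! (i - 1) < k \<and> k \<le> a ! i} | i. 1 \<le> i \<and> i < p})"

text \<open>A block ends at its element of \<open>A\<close>, and \<open>{k, k + 1}\<close> is meant to consist of two
  consecutive elements of the block: \<open>k\<close> is not its last element, i.e. \<open>k \<notin> A\<close>. For
  \<open>card A \<noteq> 1\<close> this is implied by \<open>{k, k + 1}\<close> being contained in a block. For \<open>A = {a}\<close> the only
  block is all of \<open>\<int>/N\<int>\<close>, as the cyclic interval from \<open>a + 1\<close> to \<open>a\<close>, and the condition
  excludes the pair \<open>{a, a + 1}\<close> of its two ends. (If that pair were admitted, then for
  \<open>N = 3\<close>, \<open>A = {2}\<close> the polynomial below would have the extra term \<open>X\<^sub>1\<close>, and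
  \<open>P\<^sub>A + 1\<close> would no longer be the determinant of the branch.)\<close>

definition generating_allowed :: "nat \<Rightarrow> nat set \<Rightarrow> nat set \<Rightarrow> bool" where
  "generating_allowed N A B \<longleftrightarrow> B \<subset> {..<N} \<and>
     ((\<exists>a\<in>A. B = {a}) \<or>
      (\<exists>k<N. k \<notin> A \<and> B = {k, Suc k mod N} \<and> (\<exists>C\<in>blocks N A. B \<subseteq> C)))"

definition allowed :: "nat \<Rightarrow> nat set \<Rightarrow> nat set set" where
  "allowed N A =
     {B. B \<subset> {..<N} \<and> (\<exists>F. partition_on B F \<and> (\<forall>C\<in>F. generating_allowed N A C))}"

text \<open>Polynomials with integer coefficients in the indeterminates \<open>X\<^sub>0, X\<^sub>1, \<dots>\<close>; a monomial is the
  finitely supported family of its exponents.\<close>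

type_synonym int_mpoly = "(nat \<Rightarrow>\<^sub>0 nat) \<Rightarrow>\<^sub>0 int"

definition indet :: "nat \<Rightarrow> int_mpoly" where
  "indet i = Poly_Mapping.single (Poly_Mapping.single i 1) 1"

definition poly_subst :: "(nat \<Rightarrow> 'a::comm_ring_1) \<Rightarrow> int_mpoly \<Rightarrow> 'a" where
  "poly_subst x f = (\<Sum>m\<in>Poly_Mapping.keys f. of_int (Poly_Mapping.lookup f m) *
     (\<Prod>i\<in>Poly_Mapping.keys m. x i ^ Poly_Mapping.lookup m i))"

definition P_poly :: "nat \<Rightarrow> nat set \<Rightarrow> int_mpoly" where
  "P_poly N A = (\<Sum>B\<in>allowed N A. \<Prod>i\<in>{..<N} - B. indet i)"

definition P_seq :: "nat list \<Rightarrow> int_mpoly" where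
  "P_seq \<sigma> = P_poly (num_sing \<sigma>) (A_of \<sigma>)"

definition Delta :: "nat list \<Rightarrow> int_mpoly" where
  "Delta \<sigma> = P_seq \<sigma> + 1"

text \<open>\<open>in_group \<sigma>s i f\<close> is \<open>f(X\<^sub>n, X\<^sub>n\<^sub>+\<^sub>1, \<dots>)\<close>, where \<open>n\<close> is the number of singular sequences in
  \<open>\<sigma>\<^sub>0 \<dots> \<sigma>\<^sub>i\<^sub>-\<^sub>1\<close>: the indeterminates of the polynomial of \<open>\<sigma>\<^sub>i\<close> are the \<open>i\<close>-th group.\<close>

definition in_group :: "nat list list \<Rightarrow> nat \<Rightarrow> int_mpoly \<Rightarrow> int_mpoly" where
  "in_group \<sigma>s i = poly_subst (\<lambda>j. indet ((\<Sum>l<i. num_sing (\<sigma>s ! l)) + j))"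

definition at_lengths :: "nat list \<Rightarrow> int_mpoly \<Rightarrow> int" where
  "at_lengths \<sigma> = poly_subst (\<lambda>j. int (sing_lengths \<sigma> ! j))"

definition branch :: "nat list \<Rightarrow> int list" where
  "branch \<tau> = (let ks = sing_lengths \<tau>; p = length ks in
     concat (map (\<lambda>i. if even i then replicate (ks ! i - 1) 2 else [int (ks ! i) + 2]) [0..<p]) @
     (if odd p then [2] else []))"

definition chain_matrix :: "int list \<Rightarrow> int mat" where
  "chain_matrix b = mat (length b) (length b)
     (\<lambda>(i, j). if i = j then b ! i else if i = Suc j \<or> j = Suc i then - 1 else 0)"

definition chain_det :: "int list \<Rightarrow> int" where
  "chain_det b = det (chain_matrix b)"

end

theory Submission
  imports Defs
begin

text \<open>
  Adding \<open>1\<close> to \<open>P\<^sub>A\<close> makes it multiplicative, because \<open>1\<close> is the term of the one tileable subset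
  that is not allowed: all of \<open>\<int>/N\<int>\<close>, whose product \<open>\<Prod>\<^bsub>i \<notin> B\<^esub> X\<^sub>i\<close> is empty. So \<open>P\<^sub>A + 1\<close> is the
  sum of \<open>\<Prod>\<^bsub>i \<notin> B\<^esub> X\<^sub>i\<close> over all subsets \<open>B\<close> that are disjoint unions of tiles, a tile being \<open>{a}\<close>
  with \<open>a \<in> A\<close> or \<open>{k, k + 1}\<close> with \<open>k \<notin> A\<close> (lemma \<open>P_poly_plus_1\<close>). Each simple sequence ends
  with a regular one, so the last index of each group lies in \<open>A\<close>. Hence no tile crosses from one
  group to the next, nor from \<open>N - 1\<close> back to \<open>0\<close>; the tileable sets are chosen independently in
  the groups, and the sum factors (lemma \<open>tiling_sum_groups\<close>).

  The factor of one group is found by looking at its first index \<open>s\<close>. Either \<open>s \<notin> B\<close>, which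
  contributes \<open>X\<^sub>s\<close>, or \<open>B\<close> starts with the only tile that can begin at \<open>s\<close>, which is \<open>{s, s + 1}\<close>
  unless \<open>s\<close> is the last index (lemma \<open>tiling_sum_rec\<close>). This is the recursion of a continuant with
  signs \<open>+\<close> and with last entry \<open>X + 1\<close>, the \<open>capped_continuant\<close> below.

  The determinant of a branch satisfies the same recursion. Expanding a tridiagonal determinant at
  its first row and column gives a continuant with signs \<open>-\<close>, and a run of \<open>k - 1\<close> entries \<open>2\<close>
  followed by \<open>l + 2\<close> turns into the two entries \<open>k\<close>, \<open>l\<close> of a continuant with signs \<open>+\<close>, as in the
  usual passage between the two kinds of continued fractions (lemma \<open>chain_det_branch_chain\<close>).

  It then remains to evaluate at the lengths of the singular sequences, which is a ring
  homomorphism and so respects the products and the continuants. Since \<open>P\<^sub>A = \<Delta> - 1\<close>, the formulas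
  for \<open>P\<close> are those for \<open>\<Delta>\<close>.
\<close>

section \<open>Capped continuants\<close>

text \<open>With \<open>K\<close> the continuant with signs \<open>+\<close>, given by \<open>K() = 1\<close>, \<open>K(x) = x\<close> and
  \<open>K(x\<^sub>1, \<dots>, x\<^sub>p) = x\<^sub>1 K(x\<^sub>2, \<dots>, x\<^sub>p) + K(x\<^sub>3, \<dots>, x\<^sub>p)\<close>, this is
  \<open>K(x\<^sub>1, \<dots>, x\<^sub>p\<^sub>-\<^sub>1, x\<^sub>p + 1)\<close> for \<open>p \<ge> 1\<close>.\<close>

fun capped_continuant :: "'a::comm_ring_1 list \<Rightarrow> 'a" where
  "capped_continuant [] = 1"
| "capped_continuant [x] = x + 1"
| "capped_continuant (x # y # zs) = x * capped_continuant (y # zs) + capped_continuant zs"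

text \<open>The case of a single entry fits the general recursion because \<open>tl [] = []\<close>. So
  an induction step that prefixes an entry need not ask whether the rest is empty.\<close>

lemma capped_continuant_Cons:
  "capped_continuant (x # xs) = x * capped_continuant xs + capped_continuant (tl xs)"
  by (cases xs) simp_all

section \<open>Substitution is a ring homomorphism\<close>

definition monom_subst :: "(nat \<Rightarrow> 'a::comm_ring_1) \<Rightarrow> (nat \<Rightarrow>\<^sub>0 nat) \<Rightarrow> 'a" where
  "monom_subst x m = (\<Prod>i\<in>Poly_Mapping.keys m. x i ^ Poly_Mapping.lookup m i)"

lemma monom_subst_superset:
  assumes "finite I" "Poly_Mapping.keys m \<subseteq> I"
  shows "monom_subst x m = (\<Prod>i\<in>I. x i ^ Poly_Mapping.lookup m i)"
  unfolding monom_subst_def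
  by (rule prod.mono_neutral_left) (use assms in \<open>auto simp: in_keys_iff\<close>)

lemma monom_subst_add: "monom_subst x (m + n) = monom_subst x m * monom_subst x n"
proof -
  let ?I = "Poly_Mapping.keys m \<union> Poly_Mapping.keys n"
  have "monom_subst x (m + n) = (\<Prod>i\<in>?I. x i ^ Poly_Mapping.lookup (m + n) i)"
    by (rule monom_subst_superset) (simp_all add: keys_add)
  also have "\<dots> = monom_subst x m * monom_subst x n"
    by (simp add: monom_subst_superset[of ?I] lookup_add power_add prod.distrib)
  finally show ?thesis .
qed

lemma poly_subst_alt:
  "poly_subst x f =
     (\<Sum>m\<in>Poly_Mapping.keys f. of_int (Poly_Mapping.lookup f m) * monom_subst x m)"
  by (simp add: poly_subst_def monom_subst_def)

lemma poly_subst_add: "poly_subst x (f + g) = poly_subst x f + poly_subst x g"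
  unfolding poly_subst_alt by (rule setsum_keys_plus_distrib) (simp_all add: distrib_right)

lemma poly_subst_0 [simp]: "poly_subst x 0 = 0"
  by (simp add: poly_subst_alt)

lemma poly_subst_diff: "poly_subst x (f - g) = poly_subst x f - poly_subst x g"
  using poly_subst_add[of x "f - g" g] by simp

lemma poly_subst_single:
  "poly_subst x (Poly_Mapping.single m c) = of_int c * monom_subst x m"
  by (simp add: poly_subst_alt)

lemma poly_subst_1 [simp]: "poly_subst x 1 = 1"
  by (simp add: poly_subst_single monom_subst_def flip: single_one)

lemma poly_subst_indet [simp]: "poly_subst x (indet i) = x i"
  by (simp add: indet_def poly_subst_single monom_subst_def)

text \<open>A polynomial is an integer combination of monomials, that is, an element of a free abelian
  group; substitution is additive, so induction over that group in each factor reduces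
  multiplicativity to products of two monomials.\<close>

lemma poly_subst_mult: "poly_subst x (f * g) = poly_subst x f * poly_subst x g"
proof (induction f rule: frag_induction[OF subset_UNIV, case_names zero one diff])
  case (one m)
  show ?case
  proof (induction g rule: frag_induction[OF subset_UNIV, case_names zero one diff])
    case (one n)
    show ?case
      by (simp add: mult_single poly_subst_single monom_subst_add)
  qed (simp_all add: poly_subst_diff right_diff_distrib)
qed (simp_all add: poly_subst_diff left_diff_distrib)

lemma poly_subst_prod: "poly_subst x (\<Prod>i\<in>I. f i) = (\<Prod>i\<in>I. poly_subst x (f i))"
  by (induction I rule: infinite_finite_induct) (simp_all add: poly_subst_mult)

lemma poly_subst_capped_continuant:
  "poly_subst x (capped_continuant fs) = capped_continuant (map (poly_subst x) fs)"
  by (induction fs rule: capped_continuant.induct) (simp_all add: poly_subst_add poly_subst_mult)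

section \<open>Sums over tileable sets\<close>

text \<open>Tiles are not reduced modulo \<open>N\<close> and may fill the whole interval. They agree with the
  generating allowed subsets, up to properness, as soon as \<open>N - 1 \<in> A\<close>
  (lemma \<open>generating_allowed_iff\<close>).\<close>

definition tile :: "nat set \<Rightarrow> nat set \<Rightarrow> bool" where
  "tile A C \<longleftrightarrow> (\<exists>a\<in>A. C = {a}) \<or> (\<exists>k. k \<notin> A \<and> C = {k, Suc k})"

definition tileable :: "nat set \<Rightarrow> nat set \<Rightarrow> bool" where
  "tileable A B \<longleftrightarrow> (\<exists>F. partition_on B F \<and> (\<forall>C\<in>F. tile A C))"

lemma tileable_empty [simp]: "tileable A {}"
  by (auto simp: tileable_def partition_on_empty)

lemma tileable_Un_tile:
  assumes "tile A C" "tileable A B" "C \<inter> B = {}"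
  shows "tileable A (C \<union> B)"
proof -
  obtain F where F: "partition_on B F" "\<forall>D\<in>F. tile A D"
    using assms by (auto simp: tileable_def)
  have "C \<noteq> {}"
    using assms by (auto simp: tile_def)
  have "\<Union>F = B"
    using F by (simp add: partition_on_def)
  then have "partition_on (C \<union> B) (insert C F)"
    using F(1) assms(3) \<open>C \<noteq> {}\<close>
    by (subst partition_on_insert) (auto simp: disjnt_def Un_Diff Diff_triv Int_commute)
  then show ?thesis
    using F assms(1) unfolding tileable_def by blast
qed

text \<open>Exactly one tile begins at \<open>s\<close>, namely \<open>{s..<tile_end A s}\<close>.\<close>

definition tile_end :: "nat set \<Rightarrow> nat \<Rightarrow> nat" where
  "tile_end A s = (if s \<in> A then Suc s else Suc (Suc s))"

lemma tile_at: "tile A {s..<tile_end A s}"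
proof -
  have "{s..<Suc s} = {s}" "{s..<Suc (Suc s)} = {s, Suc s}"
    by auto
  then show ?thesis
    by (auto simp: tile_def tile_end_def)
qed

text \<open>A tile that contains the least element of \<open>B\<close> must begin there, so it is determined by \<open>A\<close>.\<close>

lemma tileable_Diff_tile:
  assumes "tileable A B" "s \<in> B" "B \<subseteq> {s..}"
  shows "{s..<tile_end A s} \<subseteq> B" "tileable A (B - {s..<tile_end A s})"
proof -
  obtain F where F: "partition_on B F" "\<forall>D\<in>F. tile A D"
    using assms by (auto simp: tileable_def)
  then obtain C where C: "C \<in> F" "s \<in> C"
    using assms(2) by (auto simp: partition_on_def)
  have "C \<subseteq> B"
    using C F by (auto simp: partition_on_def)
  have ge: "s \<le> i" if "i \<in> C" for i
    using that \<open>C \<subseteq> B\<close> assms(3) by auto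
  have "tile A C"
    using C F by auto
  then have "C = {s..<tile_end A s}"
    unfolding tile_def
  proof (elim disjE exE bexE conjE)
    fix a assume "a \<in> A" "C = {a}"
    then show ?thesis
      using C(2) by (simp add: tile_end_def)
  next
    fix k assume k: "k \<notin> A" "C = {k, Suc k}"
    then have "s = k"
      using ge[of k] C(2) by auto
    with k show ?thesis
      by (auto simp: tile_end_def)
  qed
  moreover have "partition_on (B - C) (F - {C})"
  proof -
    have "disjnt C (\<Union>(F - {C}))"
      using partition_onD2[OF F(1)] C(1) by (auto simp: pairwise_def)
    then show ?thesis
      using partition_on_insert[of C "F - {C}" B] F(1) C(1) by (simp add: insert_absorb)
  qed
  moreover have "\<forall>D\<in>F - {C}. tile A D"
    using F(2) by simp
  ultimately show "{s..<tile_end A s} \<subseteq> B" "tileable A (B - {s..<tile_end A s})"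
    using \<open>C \<subseteq> B\<close> unfolding tileable_def by blast+
qed

definition tileable_in :: "nat set \<Rightarrow> nat \<Rightarrow> nat \<Rightarrow> nat set set" where
  "tileable_in A s N = {B. B \<subseteq> {s..<N} \<and> tileable A B}"

definition tiling_sum :: "nat set \<Rightarrow> (nat \<Rightarrow> 'a::comm_ring_1) \<Rightarrow> nat \<Rightarrow> nat \<Rightarrow> 'a" where
  "tiling_sum A X s N = (\<Sum>B\<in>tileable_in A s N. \<Prod>i\<in>{s..<N} - B. X i)"

lemma finite_tileable_in: "finite (tileable_in A s N)"
  by (rule finite_subset[of _ "Pow {s..<N}"]) (auto simp: tileable_in_def)

lemma tiling_sum_empty [simp]: "tiling_sum A X s s = 1"
proof -
  have "tileable_in A s s = {{}}"
    by (auto simp: tileable_in_def)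
  then show ?thesis
    by (simp add: tiling_sum_def)
qed

text \<open>The first summand collects the sets \<open>B\<close> with \<open>s \<notin> B\<close>; those with \<open>s \<in> B\<close> are the unions of
  the tile at \<open>s\<close> with a tileable set to its right, and this tile contributes no indeterminate.\<close>

lemma tiling_sum_rec:
  assumes "tile_end A s \<le> N"
  shows "tiling_sum A X s N = X s * tiling_sum A X (Suc s) N + tiling_sum A X (tile_end A s) N"
proof -
  let ?t = "tile_end A s"
  let ?C = "{s..<?t}"
  have s: "s < ?t" "s < N"
    using assms by (auto simp: tile_end_def split: if_splits)
  have split: "tileable_in A s N = tileable_in A (Suc s) N \<union> (\<union>) ?C ` tileable_in A ?t N"
    (is "?L = ?M \<union> ?R")
  proof
    show "?L \<subseteq> ?M \<union> ?R"
    proof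
      fix B assume "B \<in> ?L"
      then have B: "B \<subseteq> {s..<N}" "tileable A B"
        by (auto simp: tileable_in_def)
      show "B \<in> ?M \<union> ?R"
      proof (cases "s \<in> B")
        case True
        have "B \<subseteq> {s..}"
          using B(1) by auto
        note C = tileable_Diff_tile[OF B(2) True this]
        then have "B - ?C \<in> tileable_in A ?t N"
          using B by (auto simp: tileable_in_def)
        moreover have "B = ?C \<union> (B - ?C)"
          using C by auto
        ultimately show ?thesis
          by blast
      next
        case False
        then have "B \<subseteq> {Suc s..<N}"
          using B(1) by (auto simp: Suc_le_eq le_less)
        then show ?thesis
          using B by (simp add: tileable_in_def)
      qed
    qed
    show "?M \<union> ?R \<subseteq> ?L"
    proof
      fix B assume "B \<in> ?M \<union> ?R"
      then show "B \<in> ?L"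
      proof
        assume "B \<in> ?M"
        then show ?thesis
          unfolding tileable_in_def by fastforce
      next
        assume "B \<in> ?R"
        then obtain D where D: "B = ?C \<union> D" "D \<subseteq> {?t..<N}" "tileable A D"
          by (auto simp: tileable_in_def)
        then have "tileable A B"
          by (auto intro!: tileable_Un_tile tile_at)
        moreover have "B \<subseteq> {s..<N}"
          using D(1,2) s assms by fastforce
        ultimately show ?thesis
          by (simp add: tileable_in_def)
      qed
    qed
  qed
  have inj: "inj_on ((\<union>) ?C) (tileable_in A ?t N)"
  proof (rule inj_onI)
    fix B D
    assume "B \<in> tileable_in A ?t N" "D \<in> tileable_in A ?t N" and eq: "?C \<union> B = ?C \<union> D"
    then have "?C \<inter> B = {}" "?C \<inter> D = {}"
      by (auto simp: tileable_in_def)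
    with eq show "B = D"
      by blast
  qed
  have s_notin: "s \<notin> B" if "B \<in> ?M" for B
    using that unfolding tileable_in_def by fastforce
  have s_in: "s \<in> B" if "B \<in> ?R" for B
    using that s(1) by auto
  let ?f = "\<lambda>B. \<Prod>i\<in>{s..<N} - B. X i"
  have "tiling_sum A X s N = sum ?f (?M \<union> ?R)"
    by (simp only: tiling_sum_def split)
  also have "\<dots> = sum ?f ?M + sum ?f ?R"
    by (intro sum.union_disjoint finite_imageI finite_tileable_in) (use s_notin s_in in blast)
  also have "sum ?f ?M = (\<Sum>B\<in>?M. X s * (\<Prod>i\<in>{Suc s..<N} - B. X i))"
  proof (rule sum.cong[OF refl])
    fix B assume "B \<in> ?M"
    have "{s..<N} = insert s {Suc s..<N}"
      using s(2) by auto
    then have "{s..<N} - B = insert s ({Suc s..<N} - B)"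
      using s_notin[OF \<open>B \<in> ?M\<close>] by blast
    then show "?f B = X s * (\<Prod>i\<in>{Suc s..<N} - B. X i)"
      by simp
  qed
  also have "\<dots> = X s * tiling_sum A X (Suc s) N"
    by (simp add: tiling_sum_def sum_distrib_left)
  also have "sum ?f ?R = (\<Sum>B\<in>tileable_in A ?t N. ?f (?C \<union> B))"
    by (simp only: sum.reindex[OF inj] o_def)
  also have "\<dots> = tiling_sum A X ?t N"
  proof -
    have "{s..<N} - (?C \<union> B) = {?t..<N} - B" for B
      using s(1) by auto
    then show ?thesis
      by (simp only: tiling_sum_def)
  qed
  finally show ?thesis .
qed

text \<open>Placing tiles greedily from the left succeeds: a tile of size two never sticks out on the
  right, since it does not begin at \<open>N - 1\<close>.\<close>

lemma tileable_interval:
  assumes "s < N \<longrightarrow> N - 1 \<in> A"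
  shows "tileable A {s..<N}"
  using assms
proof (induction "N - s" arbitrary: s rule: less_induct)
  case less
  show ?case
  proof (cases "s < N")
    case True
    let ?t = "tile_end A s"
    have "s \<in> A \<or> Suc s < N"
      using True less.prems by (cases "N = Suc s") auto
    then have t: "s < ?t" "?t \<le> N"
      using True by (auto simp: tile_end_def)
    then have "tileable A {?t..<N}"
      using less.prems by (intro less.hyps) auto
    then have "tileable A ({s..<?t} \<union> {?t..<N})"
      by (intro tileable_Un_tile tile_at) auto
    then show ?thesis
      using t by (simp add: ivl_disj_un)
  qed simp
qed

text \<open>The hypothesis allows \<open>s = e\<close>, the empty group, which the induction reaches after a tile of
  size two at \<open>e - 2\<close>.\<close>

lemma tiling_sum_group:
  assumes "\<forall>i\<in>{s..<e}. i \<in> A \<longleftrightarrow> Suc i = e" "s \<le> e" "e \<le> N"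
  shows "tiling_sum A X s N = capped_continuant (map X [s..<e]) * tiling_sum A X e N"
  using assms(1,2)
proof (induction "e - s" arbitrary: s rule: less_induct)
  case less
  consider "s = e" | "Suc s = e" | "Suc (Suc s) \<le> e"
    using less.prems(2) by linarith
  then show ?case
  proof cases
    case 2
    then have "s \<in> A"
      using less.prems by auto
    then show ?thesis
      using tiling_sum_rec[of A s N X] assms(3)
      unfolding 2[symmetric] by (simp add: tile_end_def distrib_right)
  next
    case 3
    then have "s \<notin> A"
      using less.prems by auto
    then have "tiling_sum A X s N =
        X s * tiling_sum A X (Suc s) N + tiling_sum A X (Suc (Suc s)) N"
      using tiling_sum_rec[of A s N X] 3 assms(3) by (simp add: tile_end_def)
    also have "tiling_sum A X (Suc s) N =
        capped_continuant (map X [Suc s..<e]) * tiling_sum A X e N"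
      using less.prems 3 by (intro less.hyps) auto
    also have "tiling_sum A X (Suc (Suc s)) N =
        capped_continuant (map X [Suc (Suc s)..<e]) * tiling_sum A X e N"
      using less.prems 3 by (intro less.hyps) auto
    also have "X s * (capped_continuant (map X [Suc s..<e]) * tiling_sum A X e N) +
          capped_continuant (map X [Suc (Suc s)..<e]) * tiling_sum A X e N =
        capped_continuant (map X [s..<e]) * tiling_sum A X e N"
    proof -
      have "[s..<e] = s # [Suc s..<e]" "tl [Suc s..<e] = [Suc (Suc s)..<e]"
        using 3 by (simp_all add: upt_conv_Cons)
      then show ?thesis
        by (simp add: capped_continuant_Cons map_tl[symmetric] distrib_right mult.assoc)
    qed
    finally show ?thesis .
  qed simp
qed

text \<open>The last indices of consecutive groups of the given sizes, where the first group begins at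
  \<open>s\<close>.\<close>

fun group_ends :: "nat \<Rightarrow> nat list \<Rightarrow> nat set" where
  "group_ends s [] = {}"
| "group_ends s (n # ns) = insert (s + n - 1) (group_ends (s + n) ns)"

lemma group_ends_subset:
  assumes "\<forall>n\<in>set ns. 1 \<le> n"
  shows "group_ends s ns \<subseteq> {s..<s + sum_list ns}"
  using assms
proof (induction ns arbitrary: s)
  case (Cons n ns)
  then have "group_ends (s + n) ns \<subseteq> {s + n..<s + n + sum_list ns}"
    by simp
  then show ?case
    using Cons.prems by auto
qed simp

lemma last_in_group_ends:
  assumes "\<forall>n\<in>set ns. 1 \<le> n" "ns \<noteq> []"
  shows "s + sum_list ns - 1 \<in> group_ends s ns"
  using assms
proof (induction ns arbitrary: s)
  case (Cons n ns)
  show ?case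
  proof (cases "ns = []")
    case False
    then show ?thesis
      using Cons.IH[of "s + n"] Cons.prems by (simp add: add.assoc)
  qed simp
qed simp

text \<open>The groups are split off from the left; the indices of the later groups do not change, which
  is why the starting point \<open>s\<close> varies in the induction.\<close>

lemma tiling_sum_groups:
  assumes "\<forall>n\<in>set ns. 1 \<le> n" "A \<inter> {s..<s + sum_list ns} = group_ends s ns"
  shows "tiling_sum A X s (s + sum_list ns) = (\<Prod>i<length ns.
           capped_continuant (map (\<lambda>j. X (s + sum_list (take i ns) + j)) [0..<ns ! i]))"
  using assms
proof (induction ns arbitrary: s)
  case (Cons n ns)
  let ?N = "s + (n + sum_list ns)"
  have n: "1 \<le> n" and ns: "\<forall>n\<in>set ns. 1 \<le> n"
    using Cons.prems(1) by auto
  note sub = group_ends_subset[OF ns, of "s + n"]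
  have A: "i \<in> A \<longleftrightarrow> i = s + n - 1 \<or> i \<in> group_ends (s + n) ns" if "i \<in> {s..<?N}" for i
  proof -
    have "i \<in> A \<longleftrightarrow> i \<in> A \<inter> {s..<?N}"
      using that by simp
    also have "A \<inter> {s..<?N} = insert (s + n - 1) (group_ends (s + n) ns)"
      using Cons.prems(2) by simp
    finally show ?thesis
      by simp
  qed
  have "i \<in> A \<longleftrightarrow> Suc i = s + n" if "i \<in> {s..<s + n}" for i
    using A[of i] that n sub by auto
  then have first: "tiling_sum A X s ?N =
      capped_continuant (map X [s..<s + n]) * tiling_sum A X (s + n) ?N"
    by (intro tiling_sum_group) auto
  have shift: "map X [s..<s + n] = map (\<lambda>j. X (s + j)) [0..<n]"
    by (rule nth_equalityI) auto
  have "A \<inter> {s + n..<s + n + sum_list ns} = group_ends (s + n) ns"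
  proof -
    have "i \<in> A \<longleftrightarrow> i \<in> group_ends (s + n) ns" if "i \<in> {s + n..<s + n + sum_list ns}" for i
      using A[of i] that n by auto
    then show ?thesis
      using sub by blast
  qed
  note rest = Cons.IH[OF ns this, unfolded add.assoc]
  have "(\<Prod>i<length (n # ns). f i) = f 0 * (\<Prod>i<length ns. f (Suc i))" for f :: "nat \<Rightarrow> 'a"
    by (simp only: length_Cons prod.lessThan_Suc_shift)
  then show ?case
    unfolding sum_list.Cons first rest shift
    by (simp only: take_0 take_Suc_Cons sum_list.Nil sum_list.Cons nth_Cons_0 nth_Cons_Suc
        add.assoc add_0)
qed simp

section \<open>Allowed subsets as tileable sets\<close>

text \<open>The block is the one that ends at the first element of \<open>A\<close> that is at least \<open>k\<close>. This element
  exists because \<open>N - 1 \<in> A\<close>, and it is not \<open>k\<close> itself, so \<open>k + 1\<close> still precedes it or equals it.\<close>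

lemma consecutive_in_block:
  assumes "A \<subseteq> {..<N}" "N - 1 \<in> A" "k < N" "k \<notin> A"
  shows "\<exists>C\<in>blocks N A. {k, Suc k} \<subseteq> C"
proof -
  define a where "a = sorted_list_of_set A"
  have fin: "finite A"
    using assms(1) by (rule finite_subset) simp
  have nonempty: "A \<noteq> {}"
    using assms(2) by blast
  have set_a: "set a = A"
    using fin by (simp add: a_def)
  define P where "P i \<longleftrightarrow> i < length a \<and> k \<le> a ! i" for i
  define i where "i = (LEAST i. P i)"
  obtain l where "l < length a" "a ! l = N - 1"
    using assms(2) set_a by (metis in_set_conv_nth)
  then have "P l"
    using assms(3) by (simp add: P_def)
  then have "P i"
    unfolding i_def by (rule LeastI)
  then have i: "i < length a" "k \<le> a ! i"
    by (auto simp: P_def)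
  have "a ! i \<in> A"
    using i(1) nth_mem unfolding set_a[symmetric] by blast
  then have "a ! i \<noteq> k" and N: "a ! i < N"
    using assms(1,4) by blast+
  then have k: "Suc k \<le> a ! i"
    using i(2) by simp
  show ?thesis
  proof (cases i)
    case 0
    then have "{k, Suc k} \<subseteq> {k. k < N \<and> (k \<le> a ! 0 \<or> a ! (length a - 1) < k)}"
      using k N by simp
    moreover have "{k. k < N \<and> (k \<le> a ! 0 \<or> a ! (length a - 1) < k)} \<in> blocks N A"
      unfolding blocks_def Let_def a_def if_not_P[OF nonempty] by (rule insertI1)
    ultimately show ?thesis
      by blast
  next
    case (Suc j)
    then have "\<not> P j"
      unfolding i_def by (metis lessI not_less_Least)
    then have "{k, Suc k} \<subseteq> {k. a ! (i - 1) < k \<and> k \<le> a ! i}"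
      using k i Suc by (simp add: P_def)
    moreover have "{k. a ! (i - 1) < k \<and> k \<le> a ! i} \<in> blocks N A"
      unfolding blocks_def Let_def if_not_P[OF nonempty] a_def[symmetric]
      using i(1) Suc by (intro insertI2 CollectI exI[of _ i]) simp
    ultimately show ?thesis
      by blast
  qed
qed

lemma generating_allowed_iff:
  assumes "A \<subseteq> {..<N}" "N - 1 \<in> A"
  shows "generating_allowed N A C \<longleftrightarrow> C \<subset> {..<N} \<and> tile A C"
proof -
  \<comment> \<open>The only wrap-around would be at \<open>k = N - 1\<close>, which lies in \<open>A\<close>.\<close>
  have succ: "Suc k mod N = Suc k" if "k < N" "k \<notin> A" for k
    using that assms(2) by (cases "Suc k = N") auto
  show ?thesis
  proof
    assume "generating_allowed N A C"
    then have "C \<subset> {..<N}" and "(\<exists>a\<in>A. C = {a}) \<or> (\<exists>k<N. k \<notin> A \<and> C = {k, Suc k mod N})"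
      unfolding generating_allowed_def by blast+
    then show "C \<subset> {..<N} \<and> tile A C"
      unfolding tile_def using succ by fastforce
  next
    assume C: "C \<subset> {..<N} \<and> tile A C"
    then consider (single) "\<exists>a\<in>A. C = {a}" | (pair) k where "k \<notin> A" "C = {k, Suc k}"
      unfolding tile_def by blast
    then show "generating_allowed N A C"
    proof cases
      case single
      then show ?thesis
        using C unfolding generating_allowed_def by blast
    next
      case pair
      then have "k < N"
        using C by auto
      then have "C = {k, Suc k mod N}" "\<exists>D\<in>blocks N A. C \<subseteq> D"
        using pair succ consecutive_in_block[OF assms] by simp_all
      then show ?thesis
        using C pair \<open>k < N\<close> unfolding generating_allowed_def by blast
    qed
  qed
qed

text \<open>The parts of a partition of a proper subset are proper subsets themselves, so properness of
  the tiles comes for free.\<close>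

lemma allowed_eq:
  assumes "A \<subseteq> {..<N}" "N - 1 \<in> A"
  shows "allowed N A = tileable_in A 0 N - {{..<N}}"
proof -
  have "(\<forall>C\<in>F. generating_allowed N A C) \<longleftrightarrow> (\<forall>C\<in>F. tile A C)"
    if "B \<subset> {..<N}" "partition_on B F" for B F
  proof -
    have "C \<subset> {..<N}" if "C \<in> F" for C
      using that \<open>B \<subset> {..<N}\<close> partition_onD1[OF \<open>partition_on B F\<close>] by blast
    then show ?thesis
      by (simp add: generating_allowed_iff[OF assms])
  qed
  then show ?thesis
    unfolding allowed_def tileable_in_def tileable_def atLeast0LessThan by blast
qed

lemma P_poly_plus_1:
  assumes "A \<subseteq> {..<N}" "N - 1 \<in> A"
  shows "P_poly N A + 1 = tiling_sum A indet 0 N"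
proof -
  let ?f = "\<lambda>B. \<Prod>i\<in>{..<N} - B. indet i"
  have "{..<N} \<in> tileable_in A 0 N"
    using tileable_interval[of 0 N A] assms(2) by (simp add: tileable_in_def atLeast0LessThan)
  then have "sum ?f (tileable_in A 0 N) = ?f {..<N} + sum ?f (tileable_in A 0 N - {{..<N}})"
    by (intro sum.remove finite_tileable_in)
  then show ?thesis
    by (simp add: P_poly_def allowed_eq[OF assms] tiling_sum_def atLeast0LessThan)
qed

section \<open>Determinants of branches\<close>

lemma chain_det_Nil [simp]: "chain_det [] = 1"
  by (simp add: chain_det_def chain_matrix_def)

lemma chain_det_single [simp]: "chain_det [a] = a"
  by (simp add: chain_det_def chain_matrix_def det_single)

text \<open>In the first column only the first two entries are nonzero. Deleting the second row and the
  first column leaves a matrix whose first row is \<open>(-1, 0, \<dots>, 0)\<close>, so one more expansion suffices.\<close>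

lemma chain_det_rec: "chain_det (a # b # c) = a * chain_det (b # c) - chain_det c"
proof -
  define n where "n = length c"
  let ?M = "chain_matrix (a # b # c)"
  let ?D = "mat_delete ?M 1 0"
  have M: "?M \<in> carrier_mat (n + 2) (n + 2)"
    by (simp add: chain_matrix_def n_def)
  have D: "?D \<in> carrier_mat (n + 1) (n + 1)"
    using mat_delete_carrier[OF M, of 1 0] by simp
  have minors: "mat_delete ?M 0 0 = chain_matrix (b # c)" "mat_delete ?D 0 0 = chain_matrix c"
    by (auto intro!: eq_matI simp: chain_matrix_def mat_delete_def)
  have entries: "?M $$ (0, 0) = a" "?M $$ (1, 0) = - 1" "?D $$ (0, 0) = - 1"
    by (simp_all add: chain_matrix_def mat_delete_def)
  have "det ?D = (\<Sum>j<n + 1. ?D $$ (0, j) * cofactor ?D 0 j)"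
    using D by (rule laplace_expansion_row) simp
  also have "\<dots> = ?D $$ (0, 0) * cofactor ?D 0 0 + (\<Sum>j<n. ?D $$ (0, Suc j) * cofactor ?D 0 (Suc j))"
    by (simp add: sum.lessThan_Suc_shift del: sum.lessThan_Suc)
  also have "(\<Sum>j<n. ?D $$ (0, Suc j) * cofactor ?D 0 (Suc j)) = 0"
    by (rule sum.neutral) (auto simp: chain_matrix_def mat_delete_def n_def)
  finally have det_D: "det ?D = - det (chain_matrix c)"
    unfolding cofactor_def minors entries by simp
  have "det ?M = (\<Sum>i<n + 2. ?M $$ (i, 0) * cofactor ?M i 0)"
    using M by (rule laplace_expansion_column) simp
  also have "\<dots> = ?M $$ (0, 0) * cofactor ?M 0 0 + ?M $$ (1, 0) * cofactor ?M 1 0 +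
      (\<Sum>i<n. ?M $$ (Suc (Suc i), 0) * cofactor ?M (Suc (Suc i)) 0)"
    by (simp add: sum.lessThan_Suc_shift del: sum.lessThan_Suc)
  also have "(\<Sum>i<n. ?M $$ (Suc (Suc i), 0) * cofactor ?M (Suc (Suc i)) 0) = 0"
    by (rule sum.neutral) (auto simp: chain_matrix_def n_def)
  finally show ?thesis
    unfolding chain_det_def cofactor_def minors entries det_D by simp
qed

text \<open>Value \<open>0\<close> for the empty chain extends the continuant recursion to chains of length one
  (lemma \<open>chain_det_Cons\<close>).\<close>

definition chain_det_tl :: "int list \<Rightarrow> int" where
  "chain_det_tl b = (if b = [] then 0 else chain_det (tl b))"

lemma chain_det_Cons: "chain_det (a # b) = a * chain_det b - chain_det_tl b"
  by (cases b) (simp_all add: chain_det_tl_def chain_det_rec)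

lemma chain_det_tl_Cons [simp]: "chain_det_tl (a # b) = chain_det b"
  by (simp add: chain_det_tl_def)

text \<open>Prefixing an entry \<open>2\<close> sends the pair of \<open>det b\<close> and \<open>det (tl b)\<close> to
  \<open>2 det b - det (tl b)\<close> and \<open>det b\<close>, which preserves the difference. So the determinants grow in an
  arithmetic progression.\<close>

lemma chain_det_replicate_2:
  "chain_det (replicate n 2 @ b) - chain_det_tl (replicate n 2 @ b) = chain_det b - chain_det_tl b"
  "chain_det (replicate n 2 @ b) = (int n + 1) * chain_det b - int n * chain_det_tl b"
proof -
  show diff: "chain_det (replicate n 2 @ b) - chain_det_tl (replicate n 2 @ b) =
      chain_det b - chain_det_tl b" for n
    by (induction n) (simp_all add: chain_det_Cons)
  show "chain_det (replicate n 2 @ b) = (int n + 1) * chain_det b - int n * chain_det_tl b"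
  proof (induction n)
    case (Suc n)
    have "chain_det (replicate (Suc n) 2 @ b) =
        chain_det (replicate n 2 @ b) + (chain_det b - chain_det_tl b)"
      using diff[of n] by (simp add: chain_det_Cons)
    then show ?case
      by (simp add: Suc algebra_simps)
  qed simp
qed

text \<open>The branch is consumed two singular sequences at a time, which is the period of its pattern.\<close>

fun branch_chain :: "nat list \<Rightarrow> int list" where
  "branch_chain [] = []"
| "branch_chain [k] = replicate (k - 1) 2 @ [2]"
| "branch_chain (k # l # ks) = replicate (k - 1) 2 @ (int l + 2) # branch_chain ks"

lemma branch_chain_eq:
  "branch_chain ks =
     concat (map (\<lambda>i. if even i then replicate (ks ! i - 1) 2 else [int (ks ! i) + 2])
       [0..<length ks]) @ (if odd (length ks) then [2] else [])"
proof (induction ks rule: branch_chain.induct)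
  case (3 k l ks)
  have "[0..<length (k # l # ks)] = 0 # 1 # map (\<lambda>i. Suc (Suc i)) [0..<length ks]"
    by (rule nth_equalityI) (auto simp: nth_Cons' simp del: upt_Suc)
  with 3 show ?case
    by (simp del: upt_Suc add: comp_def cong: if_cong)
qed simp_all

text \<open>The second conjunct, \<open>det b - det (tl b) = K(k\<^sub>1, \<dots>, k\<^sub>p\<^sub>-\<^sub>1)\<close> with \<open>K\<close> the capped
  continuant, makes the induction work: both quantities are needed to prefix the next run of \<open>2\<close>s.\<close>

lemma chain_det_branch_chain:
  assumes "\<forall>k\<in>set ks. 1 \<le> k"
  shows "chain_det (branch_chain ks) = capped_continuant (map int ks) \<and>
    chain_det_tl (branch_chain ks) =
      capped_continuant (map int ks) - capped_continuant (map int (tl ks))"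
  using assms
proof (induction ks rule: branch_chain.induct)
  case 1
  then show ?case
    by (simp add: chain_det_tl_def)
next
  case (2 k)
  have "chain_det_tl [2] = 1"
    by simp
  then show ?case
    using 2 chain_det_replicate_2[of "k - 1" "[2]"] by (simp add: of_nat_diff)
next
  case (3 k l ks)
  let ?r = "replicate (k - 1) 2" and ?b = "branch_chain ks"
  let ?K = "\<lambda>ks. capped_continuant (map int ks)"
  have IH: "chain_det ?b = ?K ks" "chain_det_tl ?b = ?K ks - ?K (tl ks)"
    using 3 by simp_all
  have K: "?K (j # js) = int j * ?K js + ?K (tl js)" for j js
    by (simp add: capped_continuant_Cons map_tl)
  have det: "chain_det ((int l + 2) # ?b) = (int l + 1) * ?K ks + ?K (tl ks)"
    by (simp add: chain_det_Cons IH algebra_simps)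
  have diff: "chain_det (?r @ (int l + 2) # ?b) - chain_det_tl (?r @ (int l + 2) # ?b) =
      ?K (l # ks)"
    unfolding chain_det_replicate_2(1) det K[of l] by (simp add: IH algebra_simps)
  have "int (k - 1) = int k - 1"
    using 3 by (simp add: of_nat_diff)
  then have "chain_det (?r @ (int l + 2) # ?b) = ?K (k # l # ks)"
    unfolding chain_det_replicate_2(2) det K[of k] K[of l] by (simp add: IH algebra_simps)
  with diff show ?case
    by simp
qed

section \<open>Factorization of a concatenation of simple sequences\<close>

definition simple_of :: "nat list \<Rightarrow> nat \<Rightarrow> nat list" where
  "simple_of ks m = concat (map singular_seq ks) @ regular_seq m"

definition pieces_of :: "nat list \<Rightarrow> nat \<Rightarrow> piece list" where
  "pieces_of ks m = map Sing ks @ [Reg m]"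

text \<open>The parameters of a simple sequence are kept as a pair, so that a list of such pairs describes
  a decomposition.\<close>

definition admissible :: "nat list \<times> nat \<Rightarrow> bool" where
  "admissible = (\<lambda>(ks, m). ks \<noteq> [] \<and> (\<forall>k\<in>set ks. 1 \<le> k) \<and> 1 \<le> m)"

lemma simple_seq_iff: "simple_seq \<tau> \<longleftrightarrow> (\<exists>q. admissible q \<and> \<tau> = case_prod simple_of q)"
  by (auto simp: simple_seq_def simple_of_def admissible_def)

lemma simple_seqs_obtain:
  assumes "\<forall>\<tau>\<in>set \<sigma>s. simple_seq \<tau>"
  obtains qs where "\<sigma>s = map (case_prod simple_of) qs" "\<forall>q\<in>set qs. admissible q"
proof -
  have "\<sigma>s \<in> lists (case_prod simple_of ` Collect admissible)"
    using assms by (auto simp: simple_seq_iff in_lists_conv_set)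
  then have "\<sigma>s \<in> map (case_prod simple_of) ` lists (Collect admissible)"
    by (simp only: lists_image)
  then show thesis
    using that by (auto simp: in_lists_conv_set)
qed

lemma well_formed_Sings:
  assumes "\<forall>k\<in>set ks. 1 \<le> k"
  shows "well_formed (map Sing ks @ w) \<longleftrightarrow> well_formed w"
  using assms by (induction ks) auto

text \<open>No two regular sequences become adjacent, since each simple sequence begins with a singular
  one.\<close>

lemma well_formed_pieces:
  assumes "\<forall>q\<in>set qs. admissible q"
  shows "well_formed (concat (map (case_prod pieces_of) qs))"
  using assms
proof (induction qs)
  case (Cons q qs)
  obtain ks m where q: "q = (ks, m)" "\<forall>k\<in>set ks. 1 \<le> k" "1 \<le> m"
    using Cons.prems by (cases q) (auto simp: admissible_def)
  define w where "w = concat (map (case_prod pieces_of) qs)"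
  have "w \<noteq> Reg n # v" for n v
  proof (cases qs)
    case (Cons q' qs')
    then obtain k ks' m' where "q' = (k # ks', m')"
      using Cons.prems by (cases q'; cases "fst q'") (auto simp: admissible_def)
    then show ?thesis
      using Cons by (simp add: w_def pieces_of_def)
  qed (simp add: w_def)
  moreover have "well_formed w"
    using Cons by (simp add: w_def)
  ultimately have "well_formed (pieces_of ks m @ w)"
    using q by (simp add: pieces_of_def well_formed_Sings)
  then show ?case
    using q by (simp add: w_def)
qed simp

lemma piece_seq_pieces_of: "concat (map piece_seq (pieces_of ks m)) = simple_of ks m"
  by (simp add: pieces_of_def simple_of_def comp_def)

lemma factorization_concat_simple:
  assumes "\<forall>q\<in>set qs. admissible q"
  shows "factorization (concat (map (case_prod simple_of) qs)) =
    concat (map (case_prod pieces_of) qs)"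
proof -
  have "concat (map piece_seq (concat (map (case_prod pieces_of) qs))) =
      concat (map (case_prod simple_of) qs)"
    by (induction qs) (auto simp: piece_seq_pieces_of)
  then show ?thesis
    using factorization_eq[OF well_formed_pieces[OF assms]] by simp
qed

lemma sing_lengths_of_simps [simp]:
  "sing_lengths_of [] = []"
  "sing_lengths_of (Sing k # w) = k # sing_lengths_of w"
  "sing_lengths_of (Reg m # w) = sing_lengths_of w"
  by (simp_all add: sing_lengths_of_def)

lemma sing_lengths_of_pieces:
  "sing_lengths_of (map Sing ks @ w) = ks @ sing_lengths_of w"
  by (induction ks) simp_all

lemma sing_lengths_concat_simple:
  assumes "\<forall>q\<in>set qs. admissible q"
  shows "sing_lengths (concat (map (case_prod simple_of) qs)) = concat (map fst qs)"
  unfolding sing_lengths_def factorization_concat_simple[OF assms]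
  by (induction qs) (auto simp: pieces_of_def sing_lengths_of_pieces)

text \<open>This is the set that defines \<open>A\<close>, with indices counted from \<open>s\<close>; the offset lets the
  pieces be removed one by one from the left.\<close>

definition followed :: "nat \<Rightarrow> piece list \<Rightarrow> nat set" where
  "followed s w = {s + length (sing_lengths_of u) | u k m v. w = u @ Sing k # Reg m # v}"

lemma A_of_eq_followed: "A_of \<sigma> = followed 0 (factorization \<sigma>)"
  by (simp add: A_of_def followed_def)

lemma followed_Nil: "followed s [] = {}"
  by (simp add: followed_def)

lemma followed_Cons:
  "followed s (p # w) = {s | k m v. p # w = Sing k # Reg m # v} \<union>
     followed (s + length (sing_lengths_of [p])) w"
proof -
  have split: "(\<exists>u k m v. P u \<and> p # w = u @ Sing k # Reg m # v) \<longleftrightarrow>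
      (\<exists>k m v. P [] \<and> p # w = Sing k # Reg m # v) \<or>
      (\<exists>u k m v. P (p # u) \<and> w = u @ Sing k # Reg m # v)" for P
    by (simp only: Cons_eq_append_conv) blast
  define n where "n = length (sing_lengths_of [p])"
  have len: "length (sing_lengths_of (p # u)) = n + length (sing_lengths_of u)" for u
    unfolding n_def by (cases p) simp_all
  show ?thesis
    unfolding n_def[symmetric] followed_def set_eq_iff Un_iff mem_Collect_eq split len
    by (simp add: add.assoc)
qed

lemma followed_Reg: "followed s (Reg m # w) = followed s w"
  by (simp add: followed_Cons)

lemma followed_Sing_Reg: "followed s (Sing k # Reg m # w) = insert s (followed (Suc s) w)"
  by (simp add: followed_Cons)

lemma followed_Sing_Sing:
  "followed s (Sing k # Sing l # w) = followed (Suc s) (Sing l # w)"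
  by (simp add: followed_Cons[of s])

lemma followed_pieces:
  assumes "ks \<noteq> []"
  shows "followed s (map Sing ks @ Reg m # w) =
    insert (s + length ks - 1) (followed (s + length ks) w)"
  using assms
proof (induction ks arbitrary: s)
  case (Cons k ks)
  then show ?case
    by (cases ks) (simp_all add: followed_Sing_Reg followed_Sing_Sing)
qed simp

lemma A_of_concat_simple:
  assumes "\<forall>q\<in>set qs. admissible q"
  shows "A_of (concat (map (case_prod simple_of) qs)) = group_ends 0 (map (length \<circ> fst) qs)"
proof -
  have "followed s (concat (map (case_prod pieces_of) qs)) = group_ends s (map (length \<circ> fst) qs)"
    for s
    using assms
    by (induction qs arbitrary: s)
      (auto simp: followed_Nil pieces_of_def followed_pieces admissible_def)
  then show ?thesis
    unfolding A_of_eq_followed factorization_concat_simple[OF assms] .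
qed

section \<open>The product formulas\<close>

text \<open>Both sides of the first product formula come from this one: the left-hand side is the formula
  itself, and each factor on the right is its instance for a single simple sequence.\<close>

lemma Delta_concat_simple:
  assumes "\<forall>q\<in>set qs. admissible q" "qs \<noteq> []"
  shows "Delta (concat (map (case_prod simple_of) qs)) = (\<Prod>i<length qs.
    capped_continuant (map (\<lambda>j. indet (sum_list (take i (map (length \<circ> fst) qs)) + j))
      [0..<length (fst (qs ! i))]))"
proof -
  let ?ns = "map (length \<circ> fst) qs"
  let ?\<sigma> = "concat (map (case_prod simple_of) qs)"
  have N: "num_sing ?\<sigma> = sum_list ?ns"
    by (simp add: num_sing_def sing_lengths_concat_simple[OF assms(1)] length_concat)
  have ns: "\<forall>n\<in>set ?ns. 1 \<le> n"
    using assms(1) by (auto simp: admissible_def Suc_le_eq)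
  note A = A_of_concat_simple[OF assms(1)]
  have sub: "A_of ?\<sigma> \<subseteq> {0..<sum_list ?ns}"
    unfolding A using group_ends_subset[OF ns, of 0] by simp
  moreover have "sum_list ?ns - 1 \<in> A_of ?\<sigma>"
    unfolding A using last_in_group_ends[OF ns, of 0] assms(2) by simp
  ultimately have "Delta ?\<sigma> = tiling_sum (A_of ?\<sigma>) indet 0 (0 + sum_list ?ns)"
    using P_poly_plus_1[of "A_of ?\<sigma>" "sum_list ?ns"]
    by (simp add: Delta_def P_seq_def N atLeast0LessThan)
  also have "\<dots> = (\<Prod>i<length ?ns. capped_continuant
      (map (\<lambda>j. indet (0 + sum_list (take i ?ns) + j)) [0..<?ns ! i]))"
    by (rule tiling_sum_groups[OF ns]) (use sub A in auto)
  finally show ?thesis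
    by simp
qed

lemma Delta_simple:
  assumes "admissible q"
  shows "Delta (case_prod simple_of q) = capped_continuant (map indet [0..<length (fst q)])"
  using Delta_concat_simple[of "[q]"] assms by simp

lemma chain_det_branch:
  assumes "admissible q"
  shows "chain_det (branch (case_prod simple_of q)) = capped_continuant (map int (fst q))"
proof -
  have "sing_lengths (case_prod simple_of q) = fst q"
    using sing_lengths_concat_simple[of "[q]"] assms by simp
  then have "branch (case_prod simple_of q) = branch_chain (fst q)"
    by (simp add: branch_def branch_chain_eq Let_def)
  then show ?thesis
    using chain_det_branch_chain[of "fst q"] assms by (auto simp: admissible_def)
qed

lemma nth_concat_offset:
  assumes "i < length xss" "j < length (xss ! i)"
  shows "concat xss ! (sum_list (take i (map length xss)) + j) = xss ! i ! j"
  using assms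
proof (induction xss arbitrary: i)
  case (Cons xs xss)
  then show ?case
    by (cases i) (auto simp: nth_append add.assoc)
qed simp

theorem proposition4p38:
  fixes \<sigma> :: "nat list" and \<sigma>s :: "nat list list"
  assumes "\<sigma>s \<noteq> []"
    and "\<forall>\<tau>\<in>set \<sigma>s. simple_seq \<tau>"
    and "\<sigma> = concat \<sigma>s"
  shows "Delta \<sigma> = (\<Prod>i<length \<sigma>s. in_group \<sigma>s i (Delta (\<sigma>s ! i)))
    \<and> at_lengths \<sigma> (\<Prod>i<length \<sigma>s. in_group \<sigma>s i (Delta (\<sigma>s ! i))) =
           (\<Prod>i<length \<sigma>s. chain_det (branch (\<sigma>s ! i)))
    \<and> P_seq \<sigma> = (\<Prod>i<length \<sigma>s. in_group \<sigma>s i (P_seq (\<sigma>s ! i)) + 1) - 1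
    \<and> at_lengths \<sigma> ((\<Prod>i<length \<sigma>s. in_group \<sigma>s i (P_seq (\<sigma>s ! i)) + 1) - 1) =
           (\<Prod>i<length \<sigma>s. chain_det (branch (\<sigma>s ! i))) - 1"
proof -
  obtain qs where \<sigma>s: "\<sigma>s = map (case_prod simple_of) qs" and qs: "\<forall>q\<in>set qs. admissible q"
    using simple_seqs_obtain[OF assms(2)] .
  define ns where "ns = map (length \<circ> fst) qs"
  define off where "off i = sum_list (take i ns)" for i
  have len: "length \<sigma>s = length qs"
    by (simp add: \<sigma>s)
  have adm: "admissible (qs ! i)" if "i < length qs" for i
    using qs that by simp
  have num: "num_sing (\<sigma>s ! l) = ns ! l" if "l < length qs" for l
    using sing_lengths_concat_simple[of "[qs ! l]"] adm[OF that] that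
    by (simp add: num_sing_def \<sigma>s ns_def)
  have off: "(\<Sum>l<i. num_sing (\<sigma>s ! l)) = off i" if "i \<le> length qs" for i
  proof -
    have "(\<Sum>l<i. num_sing (\<sigma>s ! l)) = (\<Sum>l<i. take i ns ! l)"
      using that by (intro sum.cong) (auto simp: num)
    also have "\<dots> = off i"
      using that by (simp add: off_def sum_list_sum_nth ns_def atLeast0LessThan)
    finally show ?thesis .
  qed
  have \<sigma>: "\<sigma> = concat (map (case_prod simple_of) qs)"
    using assms(3) \<sigma>s by simp
  have nth: "\<sigma>s ! i = case_prod simple_of (qs ! i)" if "i < length qs" for i
    using that by (simp add: \<sigma>s)
  have group: "in_group \<sigma>s i (Delta (\<sigma>s ! i)) =
      capped_continuant (map (\<lambda>j. indet (off i + j)) [0..<length (fst (qs ! i))])"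
    if "i < length qs" for i
    using that unfolding in_group_def nth[OF that] Delta_simple[OF adm[OF that]]
    by (simp add: off poly_subst_capped_continuant comp_def)
  have Delta_eq: "Delta \<sigma> = (\<Prod>i<length \<sigma>s. in_group \<sigma>s i (Delta (\<sigma>s ! i)))"
  proof -
    have "qs \<noteq> []"
      using assms(1) \<sigma>s by simp
    then have "Delta \<sigma> = (\<Prod>i<length qs.
        capped_continuant (map (\<lambda>j. indet (off i + j)) [0..<length (fst (qs ! i))]))"
      unfolding \<sigma> off_def ns_def by (rule Delta_concat_simple[OF qs])
    also have "\<dots> = (\<Prod>i<length \<sigma>s. in_group \<sigma>s i (Delta (\<sigma>s ! i)))"
      unfolding len by (intro prod.cong) (simp_all add: group)
    finally show ?thesis .
  qed
  have lens: "sing_lengths \<sigma> = concat (map fst qs)"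
    unfolding \<sigma> by (rule sing_lengths_concat_simple[OF qs])
  have "at_lengths \<sigma> (in_group \<sigma>s i (Delta (\<sigma>s ! i))) = chain_det (branch (\<sigma>s ! i))"
    if "i < length qs" for i
  proof -
    have "map (\<lambda>j. int (sing_lengths \<sigma> ! (off i + j))) [0..<length (fst (qs ! i))] =
        map int (fst (qs ! i))"
      using nth_concat_offset[of i "map fst qs"] that
      by (intro nth_equalityI) (auto simp: lens off_def ns_def)
    then show ?thesis
      unfolding group[OF that]
      unfolding nth[OF that] chain_det_branch[OF adm[OF that]]
      by (simp add: at_lengths_def poly_subst_capped_continuant comp_def)
  qed
  then have at: "at_lengths \<sigma> (\<Prod>i<length \<sigma>s. in_group \<sigma>s i (Delta (\<sigma>s ! i))) =
      (\<Prod>i<length \<sigma>s. chain_det (branch (\<sigma>s ! i)))"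
    unfolding at_lengths_def poly_subst_prod len by (intro prod.cong) simp_all
  have "in_group \<sigma>s i (P_seq \<tau>) + 1 = in_group \<sigma>s i (Delta \<tau>)" for i \<tau>
    by (simp add: Delta_def in_group_def poly_subst_add)
  then show ?thesis
    using Delta_eq at by (simp add: Delta_def at_lengths_def poly_subst_diff eq_diff_eq)
qed

end
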